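(* Let $T$ be an indecomposable tournament. If a diamond embeds into $T$ and $T_{5}$ embeds into $T$, then $U_{5}$ and $W_{5}$ embed into $T$.
   Context: A tournament $T=(V,A)$ is a finite vertex set $V$ with an arc set $A$ of ordered pairs of distinct vertices such that for distinct $x,y\in V$, exactly one of $(x,y),(y,x)$ lies in $A$; write $x\to y$ for $(x,y)\in A$. For $X\subseteq V$, $T(X)$ is the induced subtournament on $X$. A tournament $T'$ embeds into $T$ if $T'$ is isomorphic to a subtournament of $T$. A subset $I\subseteq V$ is an interval of $T$ if for every $x\in V\setminus I$, either $x\to y$ for all $y\in I$ or $y\to x$ for all $y\in I$. The sets $\emptyset$, $V$ and singletons are trivial intervals; $T$ is indecomposable if all its intervals are trivial. A diamond is a tournament on 4 vertices having exactly one interval of cardinality 3. For $n\ge 2$: $T_{2n+1}$ is the tournament on $\mathbb{Z}/(2n+1)\mathbb{Z}$ with arcs $\{(i,j): j-i\in\{1,\dots,n\}\}$; $U_{2n+1}$ is obtained from $T_{2n+1}$ (on vertex set $\{0,\dots,2n\}$) by reversing all arcs between vertices of $\{n+1,\dots,2n\}$; $W_{2n+1}$ is the tournament on $\{0,\dots,2n\}$ such that for $0\le i<j\le 2n-1$ we have $i\to j$, and $2i+1\to 2n\to 2i$ for $0\le i\le n-1$. *)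

theory Defs
  imports "Graph_Theory.Graph_Theory"
begin

locale tournament = pair_digraph T for T :: "'a pair_pre_digraph" +
  assumes arc_iff_no_reverse_arc:
    "x \<in> pverts T \<Longrightarrow> y \<in> pverts T \<Longrightarrow> x \<noteq> y \<Longrightarrow> (x, y) \<in> parcs T \<longleftrightarrow> (y, x) \<notin> parcs T"

definition embeds :: "'b pair_pre_digraph \<Rightarrow> 'a pair_pre_digraph \<Rightarrow> bool" where
  "embeds S T \<longleftrightarrow> (\<exists>X \<subseteq> pverts T. digraph_iso (with_proj S) (with_proj T \<restriction> X))"

definition interval :: "'a pair_pre_digraph \<Rightarrow> 'a set \<Rightarrow> bool" where
  "interval T I \<longleftrightarrow> I \<subseteq> pverts T \<and>
     (\<forall>x \<in> pverts T - I. (\<forall>y \<in> I. (x, y) \<in> parcs T) \<or> (\<forall>y \<in> I. (y, x) \<in> parcs T))"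

definition trivial_interval :: "'a pair_pre_digraph \<Rightarrow> 'a set \<Rightarrow> bool" where
  "trivial_interval T I \<longleftrightarrow> I = {} \<or> I = pverts T \<or> (\<exists>x \<in> pverts T. I = {x})"

definition indecomposable :: "'a pair_pre_digraph \<Rightarrow> bool" where
  "indecomposable T \<longleftrightarrow> (\<forall>I. interval T I \<longrightarrow> trivial_interval T I)"

definition diamond :: "'a pair_pre_digraph \<Rightarrow> bool" where
  "diamond D \<longleftrightarrow> tournament D \<and> card (pverts D) = 4 \<and> (\<exists>!I. interval D I \<and> card I = 3)"

text \<open>
  The argument \<open>n\<close> of the following three families gives the tournaments
  $T_{2n+1}$, $U_{2n+1}$ and $W_{2n+1}$ on \<open>2 * n + 1\<close> vertices, so $T_5$, $U_5$ and $W_5$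
  are the instances \<open>n = 2\<close>. The residues modulo \<open>2 * n + 1\<close> are represented by \<open>{0..2 * n}\<close>;
  differences are taken in \<open>int\<close> to avoid truncated subtraction.
\<close>

definition T_tournament :: "nat \<Rightarrow> nat pair_pre_digraph" where
  "T_tournament n = \<lparr> pverts = {0..2 * n},
     parcs = {(i, j). i \<in> {0..2 * n} \<and> j \<in> {0..2 * n} \<and>
       (int j - int i) mod (2 * int n + 1) \<in> {1..int n}} \<rparr>"

definition U_tournament :: "nat \<Rightarrow> nat pair_pre_digraph" where
  "U_tournament n = (let B = {n + 1..2 * n}; A = parcs (T_tournament n) in
     \<lparr> pverts = {0..2 * n}, parcs = (A - B \<times> B) \<union> (A \<inter> B \<times> B)\<inverse> \<rparr>)"

definition W_tournament :: "nat \<Rightarrow> nat pair_pre_digraph" where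
  "W_tournament n = \<lparr> pverts = {0..2 * n},
     parcs = {(i, j). i < j \<and> j < 2 * n}
       \<union> {(2 * i + 1, 2 * n) | i. i < n} \<union> {(2 * n, 2 * i) | i. i < n} \<rparr>"

lemma T_arc_iff:
  "(i, j) \<in> parcs (T_tournament n) \<longleftrightarrow>
     i \<le> 2 * n \<and> j \<le> 2 * n \<and> (i < j \<and> j \<le> i + n \<or> j < i \<and> j + n < i)"
proof (cases "i \<le> 2 * n \<and> j \<le> 2 * n")
  case True
  show ?thesis
  proof (cases "i \<le> j")
    case le: True
    then have "(int j - int i) mod (2 * int n + 1) = int j - int i"
      using True by (intro mod_pos_pos_trivial) auto
    then show ?thesis using True le by (auto simp: T_tournament_def)
  next
    case False
    have "(int j - int i) mod (2 * int n + 1) = (int j - int i + (2 * int n + 1)) mod (2 * int n + 1)"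
      by simp
    also have "\<dots> = int j - int i + (2 * int n + 1)"
      using True False by (intro mod_pos_pos_trivial) auto
    finally show ?thesis using True False by (auto simp: T_tournament_def)
  qed
qed (auto simp: T_tournament_def)

lemma tournamentI:
  assumes "finite (pverts T)" and "parcs T \<subseteq> pverts T \<times> pverts T"
    and "\<And>x. (x, x) \<notin> parcs T"
    and "\<And>x y. x \<in> pverts T \<Longrightarrow> y \<in> pverts T \<Longrightarrow> x \<noteq> y \<Longrightarrow>
      (x, y) \<in> parcs T \<longleftrightarrow> (y, x) \<notin> parcs T"
  shows "tournament T"
proof
  show "finite (parcs T)"
    using assms(1,2) by (meson finite_SigmaI finite_subset)
  show "fst e \<noteq> snd e" if "e \<in> parcs T" for e
    using that assms(3) by (metis prod.collapse)
  show "fst e \<in> pverts T" "snd e \<in> pverts T" if "e \<in> parcs T" for e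
    using that assms(2) by (auto simp only: subset_iff mem_Times_iff)
qed (fact assms)+

lemma tournament_T: "tournament (T_tournament n)"
proof -
  have V: "pverts (T_tournament n) = {0..2 * n}"
    by (simp add: T_tournament_def)
  show ?thesis
  proof (rule tournamentI)
    show "(x, y) \<in> parcs (T_tournament n) \<longleftrightarrow> (y, x) \<notin> parcs (T_tournament n)"
      if "x \<in> pverts (T_tournament n)" "y \<in> pverts (T_tournament n)" "x \<noteq> y" for x y
      using that by (auto simp: V T_arc_iff)
  qed (simp_all add: V T_arc_iff subset_iff)
qed

lemma U_arc_iff:
  "(i, j) \<in> parcs (U_tournament n) \<longleftrightarrow>
     (if n < i \<and> n < j then (j, i) \<in> parcs (T_tournament n) else (i, j) \<in> parcs (T_tournament n))"
proof -
  have "i \<le> 2 * n \<and> j \<le> 2 * n" if "(i, j) \<in> parcs (T_tournament n)" for i j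
    using that by (simp add: T_arc_iff)
  then show ?thesis by (auto simp: U_tournament_def Let_def)
qed

lemma tournament_U: "tournament (U_tournament n)"
proof -
  interpret T: tournament "T_tournament n" by (rule tournament_T)
  have V: "pverts (U_tournament n) = pverts (T_tournament n)"
    by (simp add: U_tournament_def T_tournament_def Let_def)
  show ?thesis
  proof (rule tournamentI)
    show "finite (pverts (U_tournament n))"
      unfolding V by (rule T.pair_finite_verts)
    show "parcs (U_tournament n) \<subseteq> pverts (U_tournament n) \<times> pverts (U_tournament n)"
      using T.wellformed' unfolding V by (auto simp: U_arc_iff split: if_splits)
    show "(x, x) \<notin> parcs (U_tournament n)" for x
      by (simp add: U_arc_iff T_arc_iff)
    show "(x, y) \<in> parcs (U_tournament n) \<longleftrightarrow> (y, x) \<notin> parcs (U_tournament n)"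
      if "x \<in> pverts (U_tournament n)" "y \<in> pverts (U_tournament n)" "x \<noteq> y" for x y
      using that T.arc_iff_no_reverse_arc[of x y] unfolding V U_arc_iff by auto
  qed
qed

lemma W_arc_iff:
  "(i, j) \<in> parcs (W_tournament n) \<longleftrightarrow>
     i < j \<and> j < 2 * n \<or> i < 2 * n \<and> j = 2 * n \<and> odd i \<or> i = 2 * n \<and> j < 2 * n \<and> even j"
proof -
  have "(\<exists>k<n. z = 2 * k + 1) \<longleftrightarrow> z < 2 * n \<and> odd z" for z
    by presburger
  moreover have "(\<exists>k<n. z = 2 * k) \<longleftrightarrow> z < 2 * n \<and> even z" for z
    by presburger
  moreover have "(i, j) \<in> parcs (W_tournament n) \<longleftrightarrow>
      i < j \<and> j < 2 * n \<or> j = 2 * n \<and> (\<exists>k<n. i = 2 * k + 1) \<or> i = 2 * n \<and> (\<exists>k<n. j = 2 * k)"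
    by (auto simp: W_tournament_def)
  ultimately show ?thesis by blast
qed

lemma tournament_W: "tournament (W_tournament n)"
proof -
  have V: "pverts (W_tournament n) = {0..2 * n}"
    by (simp add: W_tournament_def)
  show ?thesis
  proof (rule tournamentI)
    show "parcs (W_tournament n) \<subseteq> pverts (W_tournament n) \<times> pverts (W_tournament n)"
      by (auto simp: V W_arc_iff)
    show "(x, y) \<in> parcs (W_tournament n) \<longleftrightarrow> (y, x) \<notin> parcs (W_tournament n)"
      if "x \<in> pverts (W_tournament n)" "y \<in> pverts (W_tournament n)" "x \<noteq> y" for x y
      using that unfolding V W_arc_iff by auto
  qed (simp_all add: V W_arc_iff)
qed

lemma embeds_iff:
  assumes "pair_wf_digraph S"
  shows "embeds S T \<longleftrightarrow> (\<exists>f. inj_on f (pverts S) \<and> f ` pverts S \<subseteq> pverts T \<and>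
     (\<forall>x \<in> pverts S. \<forall>y \<in> pverts S. (x, y) \<in> parcs S \<longleftrightarrow> (f x, f y) \<in> parcs T))"
    (is "_ \<longleftrightarrow> (\<exists>f. ?emb f)")
proof
  interpret pair_wf_digraph S by fact
  have wf: "wf_digraph (with_proj S)" using assms by (simp add: wf_digraph_wp_iff)
  {
    assume "embeds S T"
    then obtain X h where X: "X \<subseteq> pverts T"
      and h: "pre_digraph.digraph_isomorphism (with_proj S) h"
      and eq: "with_proj T \<restriction> X = app_iso h (with_proj S)"
      unfolding embeds_def digraph_iso_def by blast
    let ?f = "iso_verts h"
    have inj: "inj_on ?f (pverts S)"
      and th: "\<And>a. a \<in> parcs S \<Longrightarrow> ?f (fst a) = iso_tail h (iso_arcs h a) \<and>
        ?f (snd a) = iso_head h (iso_arcs h a)"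
      using h by (auto simp: pre_digraph.digraph_isomorphism_def)
    have V: "X = ?f ` pverts S" and "iso_tail h = fst" "iso_head h = snd"
      using arg_cong[OF eq, of verts] arg_cong[OF eq, of tail] arg_cong[OF eq, of head]
      by simp_all
    with th have ia: "iso_arcs h a = (?f (fst a), ?f (snd a))" if "a \<in> parcs S" for a
      using that by (simp add: prod_eq_iff)
    have A: "{e \<in> parcs T. fst e \<in> X \<and> snd e \<in> X} = iso_arcs h ` parcs S"
      using arg_cong[OF eq, of arcs] by simp
    have "(x, y) \<in> parcs S \<longleftrightarrow> (?f x, ?f y) \<in> parcs T"
      if xy: "x \<in> pverts S" "y \<in> pverts S" for x y
    proof
      assume "(x, y) \<in> parcs S"
      then have "iso_arcs h (x, y) \<in> {e \<in> parcs T. fst e \<in> X \<and> snd e \<in> X}"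
        unfolding A by (rule imageI)
      then show "(?f x, ?f y) \<in> parcs T" unfolding ia[OF \<open>(x, y) \<in> parcs S\<close>] by simp
    next
      assume "(?f x, ?f y) \<in> parcs T"
      moreover have "?f x \<in> X" "?f y \<in> X" unfolding V using xy by (auto intro: imageI)
      ultimately have "(?f x, ?f y) \<in> {e \<in> parcs T. fst e \<in> X \<and> snd e \<in> X}" by simp
      then obtain a where a: "a \<in> parcs S" "(?f x, ?f y) = iso_arcs h a"
        unfolding A by (rule imageE)
      then have "?f (fst a) = ?f x" "?f (snd a) = ?f y"
        unfolding ia[OF a(1)] by simp_all
      then have "fst a = x" "snd a = y"
        using inj xy arc_fst_in_verts[OF a(1)] arc_snd_in_verts[OF a(1)]
        by (auto simp only: inj_on_eq_iff)
      with a(1) show "(x, y) \<in> parcs S" by (cases a) simp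
    qed
    then show "\<exists>f. ?emb f"
      using inj V X
      by (intro exI[of _ ?f]) (simp only: V[symmetric], simp)
  }
  {
    assume "\<exists>f. ?emb f"
    then obtain f where f: "?emb f" by blast
    let ?h = "\<lparr> iso_verts = f, iso_arcs = map_prod f f, iso_head = snd, iso_tail = fst \<rparr>"
    let ?X = "f ` pverts S"
    have inj: "inj_on f (pverts S)" using f by blast
    have "inj_on (map_prod f f) (pverts S \<times> pverts S)"
      using inj by (intro map_prod_inj_on)
    moreover have "parcs S \<subseteq> pverts S \<times> pverts S"
      using wellformed' by auto
    ultimately have "inj_on (map_prod f f) (parcs S)"
      by (rule inj_on_subset)
    then have "pre_digraph.digraph_isomorphism (with_proj S) ?h"
      using wf inj by (simp add: pre_digraph.digraph_isomorphism_def)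
    moreover have "with_proj T \<restriction> ?X = app_iso ?h (with_proj S)"
    proof (rule pre_digraph.equality)
      show "arcs (with_proj T \<restriction> ?X) = arcs (app_iso ?h (with_proj S))"
      proof (intro set_eqI iffI)
        fix e assume "e \<in> arcs (with_proj T \<restriction> ?X)"
        then have e: "e \<in> parcs T" "fst e \<in> ?X" "snd e \<in> ?X" by simp_all
        then obtain x y where xy: "x \<in> pverts S" "y \<in> pverts S" "e = (f x, f y)"
          by (metis imageE prod.collapse)
        then have "(x, y) \<in> parcs S" using f e(1) by blast
        then have "map_prod f f (x, y) \<in> map_prod f f ` parcs S" by (rule imageI)
        then show "e \<in> arcs (app_iso ?h (with_proj S))" using xy(3) by simp
      next
        fix e assume "e \<in> arcs (app_iso ?h (with_proj S))"
        then obtain x y where xy: "(x, y) \<in> parcs S" "e = (f x, f y)" by auto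
        then have "x \<in> pverts S" "y \<in> pverts S" using wellformed' by blast+
        then show "e \<in> arcs (with_proj T \<restriction> ?X)" using xy f by simp
      qed
    qed simp_all
    ultimately show "embeds S T"
      using f unfolding embeds_def digraph_iso_def by blast
  }
qed

end

theory Submission
  imports Defs
begin

text \<open>
  Numbering the vertices of $T_{2n+1}$ in the order $0, 2, 4, \dots$ modulo $2n+1$, there is an arc
  from $i$ to $j$ iff either $i < j$ and $i$, $j$ have different parity, or $j < i$ and they have
  the same parity. In this numbering every increasing sequence of positions with alternating
  parities induces a smaller $T_{2m+1}$, and appending two positions turns $T_{2n+1}$ into
  $T_{2n+3}$.

  Suppose that $U_5$ and $W_5$ do not both embed. A vertex outside a copy of $T_5$ then either
  dominates it, is dominated by it, or is a twin of one of its vertices, since each of the other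
  four types (up to rotation) yields both $U_5$ and $W_5$. Applying this to all alternating
  $5$-subsequences gives the same trichotomy for every copy $X$ of $T_{2n+1}$. Let $n$ be maximal.
  If some outside vertex is a twin of $u \in X$, then the class of twins of $u$ is not an interval,
  so some $y$ separates a twin $x$ from $u$; exchanging $u$ for $x$ shows that $y$ is itself a twin
  of a vertex of $X$ and that $X \cup \{x, y\}$ is a copy of $T_{2n+3}$. If there is no such twin,
  $X$ is an interval, so $T$ is $T_{2n+1}$, which contains no diamond.
\<close>

section \<open>Index evaluation for tournaments on five vertices\<close>

lemma all_less_five: "(\<forall>i<5. P i) \<longleftrightarrow> P 0 \<and> P 1 \<and> P 2 \<and> P 3 \<and> P (4::nat)"
  by (simp add: numeral_eq_Suc All_less_Suc conj_ac)

lemma atMost_four: "{0..2 * 2} = {0, 1, 2, 3, 4::nat}"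
  by auto

lemma nths_five: "[a, b, c, d, e] ! 0 = a" "[a, b, c, d, e] ! 1 = b" "[a, b, c, d, e] ! 2 = c"
  "[a, b, c, d, e] ! 3 = d" "[a, b, c, d, e] ! 4 = e" "[a, b, c, d, e] ! Suc 0 = b"
  by (simp_all add: numeral_eq_Suc)

section \<open>Boolean sequences that change at every step or at most once\<close>

definition flat_or_alternating :: "bool \<Rightarrow> bool \<Rightarrow> bool \<Rightarrow> bool \<Rightarrow> bool \<Rightarrow> bool" where
  "flat_or_alternating a b c d e \<longleftrightarrow>
     (a \<noteq> b \<and> b \<noteq> c \<and> c \<noteq> d \<and> d \<noteq> e) \<or>
     (b = c \<and> c = d \<and> d = e) \<or> (a = b \<and> c = d \<and> d = e) \<or>
     (a = b \<and> b = c \<and> d = e) \<or> (a = b \<and> b = c \<and> c = d)"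

text \<open>A window of five containing two successive changes must alternate throughout, and
  overlapping windows carry the pair of changes one step up or down.\<close>

lemma alternating_propagates:
  fixes t :: "nat \<Rightarrow> bool"
  assumes t: "\<And>i. i + 4 \<le> m \<Longrightarrow>
      flat_or_alternating (t i) (t (i + 1)) (t (i + 2)) (t (i + 3)) (t (i + 4))"
    and p: "p + 2 \<le> m" "t p \<noteq> t (p + 1)" "t (p + 1) \<noteq> t (p + 2)" and "4 \<le> m"
  shows "\<forall>i<m. t i \<noteq> t (i + 1)"
proof -
  have up: "q + 2 \<le> m \<longrightarrow> t q \<noteq> t (q + 1) \<and> t (q + 1) \<noteq> t (q + 2)" if "p \<le> q" for q
    using that
  proof (induction q rule: dec_induct)
    case base then show ?case using p by simp
  next
    case (step q)
    show ?case
    proof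
      assume le: "Suc q + 2 \<le> m"
      then have h: "t q \<noteq> t (q + 1)" "t (q + 1) \<noteq> t (q + 2)" using step by auto
      show "t (Suc q) \<noteq> t (Suc q + 1) \<and> t (Suc q + 1) \<noteq> t (Suc q + 2)"
      proof (cases "q + 4 \<le> m")
        case True then show ?thesis using t[of q] h by (auto simp: flat_or_alternating_def eval_nat_numeral)
      next
        case False
        \<comment> \<open>The window starting at \<open>q\<close> would overrun \<open>m\<close>, so
          the one starting at \<open>q - 1\<close> is used; \<open>4 \<le> m\<close> ensures
          \<open>q > 0\<close>.\<close>
        then obtain r where r: "q = Suc r" "r + 4 \<le> m" using le assms(5) by (cases q) auto
        then show ?thesis using t[of r] h by (auto simp: flat_or_alternating_def eval_nat_numeral)
      qed
    qed
  qed
  have dn: "t q \<noteq> t (q + 1) \<and> t (q + 1) \<noteq> t (q + 2)" if "q \<le> p" for q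
    using that
  proof (induction q rule: inc_induct)
    case base then show ?case using p by simp
  next
    case (step q)
    have le: "q + 3 \<le> m" using step(2) p(1) by simp
    show ?case
    proof (cases "q + 4 \<le> m")
      case True
      then show ?thesis using t[OF True] step by (auto simp: flat_or_alternating_def eval_nat_numeral)
    next
      case False
      then obtain r where r: "q = Suc r" "r + 4 \<le> m" using le assms(5) by (cases q) auto
      then show ?thesis using t[of r] step by (auto simp: flat_or_alternating_def eval_nat_numeral)
    qed
  qed
  have two: "t q \<noteq> t (q + 1) \<and> t (q + 1) \<noteq> t (q + 2)" if "q + 2 \<le> m" for q
    using up[of q] dn[of q] that by (cases "p \<le> q") auto
  show ?thesis
  proof (intro allI impI)
    fix i assume "i < m"
    show "t i \<noteq> t (i + 1)"
    proof (cases "i + 2 \<le> m")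
      case False
      then obtain r where "i = Suc r" "r + 2 \<le> m" using \<open>i < m\<close> assms(5) by (cases i) auto
      then show ?thesis using two[of r] by simp
    qed (use two in blast)
  qed
qed

text \<open>Two successive changes spread everywhere. Otherwise, two changes separated by a constant
  stretch lie in a common five-term subsequence of alternating parities that violates
  \<open>flat_or_alternating\<close>.\<close>

lemma changes_once_or_always:
  fixes t :: "nat \<Rightarrow> bool"
  assumes t: "\<And>i j k l m. i < j \<Longrightarrow> j < k \<Longrightarrow> k < l \<Longrightarrow> l < m \<Longrightarrow> m \<le> 2 * n \<Longrightarrow>
      odd (i + j) \<Longrightarrow> odd (j + k) \<Longrightarrow> odd (k + l) \<Longrightarrow> odd (l + m) \<Longrightarrow>
      flat_or_alternating (t i) (t j) (t k) (t l) (t m)"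
    and n: "2 \<le> n"
  shows "(\<forall>i<2 * n. t i \<noteq> t (i + 1)) \<or> (\<exists>k b. \<forall>i\<le>2 * n. t i = ((i < k) = b))"
proof (cases "\<exists>p. p + 2 \<le> 2 * n \<and> t p \<noteq> t (p + 1) \<and> t (p + 1) \<noteq> t (p + 2)")
  case True
  then obtain p where p: "p + 2 \<le> 2 * n" "t p \<noteq> t (p + 1)" "t (p + 1) \<noteq> t (p + 2)" by blast
  have "\<forall>i<2 * n. t i \<noteq> t (i + 1)"
    by (rule alternating_propagates[OF _ p], rule t) (use n in simp_all)
  then show ?thesis ..
next
  case no_double: False
  \<comment> \<open>The fifth index depends on parity: \<open>p + 2\<close> between the changes if
    \<open>q - p\<close> is odd, otherwise \<open>q + 2\<close> above them or, failing that,
    \<open>p - 1\<close> below.\<close>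
  have unique: False if pq: "p < q" "q + 1 \<le> 2 * n" "t p \<noteq> t (p + 1)" "t q \<noteq> t (q + 1)"
    "\<And>i. p < i \<Longrightarrow> i \<le> q \<Longrightarrow> t i = t (p + 1)" for p q
  proof -
    have "q \<noteq> p + 1" using no_double pq(2-4) by auto
    have tq: "t q = t (p + 1)" using pq(1) pq(5)[of q] by simp
    show False
    proof (cases "odd (q + p)")
      case True
      with \<open>q \<noteq> p + 1\<close> \<open>p < q\<close> have "p + 3 \<le> q" by presburger
      with True tq pq(2-4) pq(5)[of "p + 2"] t[of p "p + 1" "p + 2" q "q + 1"] show False
        by (auto simp: flat_or_alternating_def)
    next
      case even: False
      show False
      proof (cases "q + 2 \<le> 2 * n")
        case True
        with even \<open>q \<noteq> p + 1\<close> tq pq(1-4) t[of p "p + 1" q "q + 1" "q + 2"] show False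
          by (auto simp: flat_or_alternating_def)
      next
        case False
        \<comment> \<open>There is no room above \<open>q + 1\<close>, but then \<open>q\<close> is
          odd, hence so is \<open>p\<close>, and \<open>p - 1\<close> exists.\<close>
        with pq(2) have q: "q + 1 = 2 * n" by simp
        with even have "odd p" by presburger
        then obtain r where "p = Suc r" by (cases p) auto
        with even \<open>q \<noteq> p + 1\<close> tq pq(1-4) t[of r p "p + 1" q "q + 1"] show False
          by (auto simp: flat_or_alternating_def)
      qed
    qed
  qed
  show ?thesis
  proof (cases "\<exists>p<2 * n. t p \<noteq> t (p + 1)")
    case False
    have "t i = t 0" if "i \<le> 2 * n" for i
      using that
    proof (induction i)
      case (Suc i)
      have "t i = t (i + 1)" using False Suc.prems by (meson Suc_le_lessD)
      with Suc show ?case by (metis Suc_eq_plus1 Suc_leD)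
    qed (rule refl)
    then have "\<forall>i\<le>2 * n. t i = ((i < 0) = (\<not> t 0))" by blast
    then show ?thesis by blast
  next
    case True
    then obtain p where p: "p < 2 * n" "t p \<noteq> t (p + 1)"
      and least: "\<forall>i<p. \<not> (i < 2 * n \<and> t i \<noteq> t (i + 1))"
      using exists_least_iff[of "\<lambda>p. p < 2 * n \<and> t p \<noteq> t (p + 1)"] by blast
    have before: "t i = t (Suc i)" if "i < p" for i
      using least that less_trans[OF that p(1)] by (metis Suc_eq_plus1)
    have low: "t i = t p" if "i \<le> p" for i
      using that
    proof (induction i rule: inc_induct)
      case (step i)
      then show ?case using before by blast
    qed (rule refl)
    have high: "t i = t (p + 1)" if "i \<le> 2 * n" "p < i" for i
      using that
    proof (induction i rule: less_induct)
      case (less i)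
      show ?case
      proof (rule ccontr)
        assume ne: "t i \<noteq> t (p + 1)"
        then obtain q where q: "i = Suc q" "p < q" using less.prems by (cases i) (auto simp: less_Suc_eq)
        have mid: "t j = t (p + 1)" if "p < j" "j \<le> q" for j
          using less.IH[of j] that q less.prems by simp
        show False
        proof (rule unique[OF q(2) _ p(2) _ mid])
          show "t q \<noteq> t (q + 1)" using mid[of q] q ne by simp
        qed (use q less.prems in auto)
      qed
    qed
    have "\<forall>i\<le>2 * n. t i = ((i < p + 1) = t p)"
    proof (intro allI impI)
      fix i assume "i \<le> 2 * n"
      then show "t i = ((i < p + 1) = t p)"
        using p(2) low[of i] high[of i] by (cases "i \<le> p") auto
    qed
    then show ?thesis by blast
  qed
qed

section \<open>Embedded tournaments on five vertices\<close>

context tournament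
begin

abbreviation arc_to :: "'a \<Rightarrow> 'a \<Rightarrow> bool" (infix "\<rightarrow>\<^sub>T" 50) where
  "x \<rightarrow>\<^sub>T y \<equiv> (x, y) \<in> parcs T"

lemma arc_irrefl: "\<not> x \<rightarrow>\<^sub>T x"
  using pair_no_loops by fastforce

lemma embeds_five_vertices:
  assumes "pair_wf_digraph S" "pverts S = {0..2 * 2}"
    and "{a, b, c, d, e} \<subseteq> pverts T" "distinct [a, b, c, d, e]"
    and "\<forall>i<5. \<forall>j<5. (i, j) \<in> parcs S \<longleftrightarrow> [a, b, c, d, e] ! i \<rightarrow>\<^sub>T [a, b, c, d, e] ! j"
  shows "embeds S T"
  unfolding embeds_iff[OF assms(1)] assms(2)
proof (intro exI[of _ "(!) [a, b, c, d, e]"] conjI)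
  show "inj_on ((!) [a, b, c, d, e]) {0..2 * 2}"
    by (rule inj_on_nth) (use assms(4) in auto)
  show "(!) [a, b, c, d, e] ` {0..2 * 2} \<subseteq> pverts T"
    using assms(3) unfolding atMost_four by (auto simp: nths_five)
qed (use assms(5) in auto)

text \<open>These arcs are those of a cyclically ordered copy of \<open>T_tournament 2\<close> with
  the arc between \<open>d\<close> and \<open>e\<close> reversed; the tournament axiom supplies the
  non-arcs.\<close>

lemma embeds_U5I:
  assumes V: "{a, b, c, d, e} \<subseteq> pverts T" and "distinct [a, b, c, d, e]"
    and "a \<rightarrow>\<^sub>T b" "a \<rightarrow>\<^sub>T c" "b \<rightarrow>\<^sub>T c" "b \<rightarrow>\<^sub>T d" "c \<rightarrow>\<^sub>T d"
      "c \<rightarrow>\<^sub>T e" "d \<rightarrow>\<^sub>T a" "e \<rightarrow>\<^sub>T a" "e \<rightarrow>\<^sub>T b" "e \<rightarrow>\<^sub>T d"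
  shows "embeds (U_tournament 2) T"
proof (rule embeds_five_vertices)
  show "pair_wf_digraph (U_tournament 2)"
    using tournament_U by (simp add: tournament_def pair_digraph_def pair_fin_digraph_def)
  show "pverts (U_tournament 2) = {0..2 * 2}"
    by (simp add: U_tournament_def Let_def)
  show "\<forall>i<5. \<forall>j<5. (i, j) \<in> parcs (U_tournament 2) \<longleftrightarrow>
      [a, b, c, d, e] ! i \<rightarrow>\<^sub>T [a, b, c, d, e] ! j"
    using assms arc_irrefl arc_iff_no_reverse_arc
    unfolding all_less_five nths_five U_arc_iff T_arc_iff by auto
qed (fact assms)+

lemma embeds_W5I:
  assumes V: "{a, b, c, d, e} \<subseteq> pverts T" and "distinct [a, b, c, d, e]"
    and "a \<rightarrow>\<^sub>T b" "a \<rightarrow>\<^sub>T c" "a \<rightarrow>\<^sub>T d" "b \<rightarrow>\<^sub>T c" "b \<rightarrow>\<^sub>T d"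
      "b \<rightarrow>\<^sub>T e" "c \<rightarrow>\<^sub>T d" "d \<rightarrow>\<^sub>T e" "e \<rightarrow>\<^sub>T a" "e \<rightarrow>\<^sub>T c"
  shows "embeds (W_tournament 2) T"
proof (rule embeds_five_vertices)
  show "pair_wf_digraph (W_tournament 2)"
    using tournament_W by (simp add: tournament_def pair_digraph_def pair_fin_digraph_def)
  show "pverts (W_tournament 2) = {0..2 * 2}"
    by (simp add: W_tournament_def)
  show "\<forall>i<5. \<forall>j<5. (i, j) \<in> parcs (W_tournament 2) \<longleftrightarrow>
      [a, b, c, d, e] ! i \<rightarrow>\<^sub>T [a, b, c, d, e] ! j"
    using assms arc_irrefl arc_iff_no_reverse_arc
    unfolding all_less_five nths_five W_arc_iff by auto
qed (fact assms)+

definition T5_on :: "'a \<Rightarrow> 'a \<Rightarrow> 'a \<Rightarrow> 'a \<Rightarrow> 'a \<Rightarrow> bool" where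
  "T5_on a b c d e \<longleftrightarrow> {a, b, c, d, e} \<subseteq> pverts T \<and> distinct [a, b, c, d, e] \<and>
     a \<rightarrow>\<^sub>T b \<and> a \<rightarrow>\<^sub>T c \<and> b \<rightarrow>\<^sub>T c \<and> b \<rightarrow>\<^sub>T d \<and> c \<rightarrow>\<^sub>T d \<and>
     c \<rightarrow>\<^sub>T e \<and> d \<rightarrow>\<^sub>T e \<and> d \<rightarrow>\<^sub>T a \<and> e \<rightarrow>\<^sub>T a \<and> e \<rightarrow>\<^sub>T b"

lemma T5_on_rotate: "T5_on a b c d e \<Longrightarrow> T5_on b c d e a"
  by (auto simp: T5_on_def)

text \<open>Up to rotation, these are the four types that are neither uniform nor twins:
  out-neighbourhoods \<open>{a}\<close>, \<open>{b, c, d, e}\<close>, \<open>{a, c}\<close> and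
  \<open>{a, b, d}\<close>. In each, \<open>x\<close> together with suitable four of the five
  vertices forms a \<open>U_tournament 2\<close>, and likewise a
  \<open>W_tournament 2\<close>.\<close>

lemma T5_on_extension:
  assumes T5: "T5_on a b c d e" and x: "x \<in> pverts T" "x \<notin> {a, b, c, d, e}"
    and no: "\<not> (embeds (U_tournament 2) T \<and> embeds (W_tournament 2) T)"
  shows "\<not> (x \<rightarrow>\<^sub>T a \<and> b \<rightarrow>\<^sub>T x \<and> c \<rightarrow>\<^sub>T x \<and> d \<rightarrow>\<^sub>T x \<and> e \<rightarrow>\<^sub>T x)"
    and "\<not> (a \<rightarrow>\<^sub>T x \<and> x \<rightarrow>\<^sub>T b \<and> x \<rightarrow>\<^sub>T c \<and> x \<rightarrow>\<^sub>T d \<and> x \<rightarrow>\<^sub>T e)"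
    and "\<not> (x \<rightarrow>\<^sub>T a \<and> b \<rightarrow>\<^sub>T x \<and> x \<rightarrow>\<^sub>T c \<and> d \<rightarrow>\<^sub>T x \<and> e \<rightarrow>\<^sub>T x)"
    and "\<not> (x \<rightarrow>\<^sub>T a \<and> x \<rightarrow>\<^sub>T b \<and> c \<rightarrow>\<^sub>T x \<and> x \<rightarrow>\<^sub>T d \<and> e \<rightarrow>\<^sub>T x)"
proof -
  show "\<not> (x \<rightarrow>\<^sub>T a \<and> b \<rightarrow>\<^sub>T x \<and> c \<rightarrow>\<^sub>T x \<and> d \<rightarrow>\<^sub>T x \<and> e \<rightarrow>\<^sub>T x)"
    using no T5 x embeds_U5I[of a b c x e] embeds_W5I[of d e x a b] by (auto simp: T5_on_def)
  show "\<not> (a \<rightarrow>\<^sub>T x \<and> x \<rightarrow>\<^sub>T b \<and> x \<rightarrow>\<^sub>T c \<and> x \<rightarrow>\<^sub>T d \<and> x \<rightarrow>\<^sub>T e)"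
    using no T5 x embeds_U5I[of d e a b x] embeds_W5I[of a x b c e] by (auto simp: T5_on_def)
  show "\<not> (x \<rightarrow>\<^sub>T a \<and> b \<rightarrow>\<^sub>T x \<and> x \<rightarrow>\<^sub>T c \<and> d \<rightarrow>\<^sub>T x \<and> e \<rightarrow>\<^sub>T x)"
    using no T5 x embeds_U5I[of c d e x b] embeds_W5I[of d e x a b] by (auto simp: T5_on_def)
  show "\<not> (x \<rightarrow>\<^sub>T a \<and> x \<rightarrow>\<^sub>T b \<and> c \<rightarrow>\<^sub>T x \<and> x \<rightarrow>\<^sub>T d \<and> e \<rightarrow>\<^sub>T x)"
    using no T5 x embeds_U5I[of a b c d x] embeds_W5I[of e x a b d] by (auto simp: T5_on_def)
qed

section \<open>Copies of \<open>T_tournament n\<close> in the parity numbering\<close>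

text \<open>The vertex at position \<open>i\<close> plays the role of \<open>2 * i\<close> modulo
  \<open>2 * n + 1\<close>; order and parity replace modular arithmetic.\<close>

definition circular :: "nat \<Rightarrow> (nat \<Rightarrow> 'a) \<Rightarrow> bool" where
  "circular n f \<longleftrightarrow> f ` {..2 * n} \<subseteq> pverts T \<and>
     (\<forall>i\<le>2 * n. \<forall>j\<le>2 * n. f i \<rightarrow>\<^sub>T f j \<longleftrightarrow> i \<noteq> j \<and> (i < j \<longleftrightarrow> even i \<noteq> even j))"

lemma circularI:
  assumes "\<And>i. i \<le> 2 * n \<Longrightarrow> f i \<in> pverts T"
    and "\<And>i j. i \<le> 2 * n \<Longrightarrow> j \<le> 2 * n \<Longrightarrow>
      f i \<rightarrow>\<^sub>T f j \<longleftrightarrow> i \<noteq> j \<and> (i < j \<longleftrightarrow> even i \<noteq> even j)"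
  shows "circular n f"
  using assms by (auto simp: circular_def)

lemma circular_verts: "circular n f \<Longrightarrow> i \<le> 2 * n \<Longrightarrow> f i \<in> pverts T"
  by (auto simp: circular_def)

lemma circular_arc:
  "circular n f \<Longrightarrow> i \<le> 2 * n \<Longrightarrow> j \<le> 2 * n \<Longrightarrow>
    f i \<rightarrow>\<^sub>T f j \<longleftrightarrow> i \<noteq> j \<and> (i < j \<longleftrightarrow> even i \<noteq> even j)"
  by (auto simp: circular_def)

lemma circular_inj:
  assumes "circular n f"
  shows "inj_on f {..2 * n}"
proof (rule inj_onI, rule ccontr)
  fix i j assume ij: "i \<in> {..2 * n}" "j \<in> {..2 * n}" "f i = f j" "i \<noteq> j"
  then have "f i \<rightarrow>\<^sub>T f j \<or> f j \<rightarrow>\<^sub>T f i"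
    using circular_arc[OF assms, of i j] circular_arc[OF assms, of j i] by auto
  with ij(3) show False by (simp add: arc_irrefl)
qed

lemma circular_eq_iff:
  "circular n f \<Longrightarrow> i \<le> 2 * n \<Longrightarrow> j \<le> 2 * n \<Longrightarrow> f i = f j \<longleftrightarrow> i = j"
  using circular_inj[of n f] by (auto simp: inj_on_eq_iff)

text \<open>Moving position 0 to the end reverses its order relation to every other position and,
  \<open>2 * n\<close> being even, also flips the relative parity, so the arc rule is
  preserved.\<close>

lemma circular_rotate:
  assumes "circular n f"
  shows "circular n (\<lambda>i. if i = 2 * n then f 0 else f (i + 1))"
proof -
  have "f i \<in> pverts T" if "i \<le> 2 * n" for i using that circular_verts[OF assms] by blast
  moreover have "f i \<rightarrow>\<^sub>T f j \<longleftrightarrow> i \<noteq> j \<and> (i < j \<longleftrightarrow> even i \<noteq> even j)"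
    if "i \<le> 2 * n" "j \<le> 2 * n" for i j using that circular_arc[OF assms] by blast
  ultimately show ?thesis by (auto simp: circular_def)
qed

lemma circular_rotate_to_0:
  assumes "circular n f" "u \<le> 2 * n"
  shows "\<exists>g. circular n g \<and> g ` {..2 * n} = f ` {..2 * n} \<and> g 0 = f u"
  using assms
proof (induction u arbitrary: f)
  case 0 then show ?case by blast
next
  case (Suc u)
  let ?g = "\<lambda>i. if i = 2 * n then f 0 else f (i + 1)"
  have "?g ` {..2 * n} = f ` {..2 * n}"
  proof (intro subset_antisym image_subsetI)
    fix i assume "i \<in> {..2 * n}"
    show "f i \<in> ?g ` {..2 * n}"
    proof (cases i)
      case 0 then show ?thesis by (intro image_eqI[of _ _ "2 * n"]) auto
    next
      case (Suc k)
      then show ?thesis using \<open>i \<in> _\<close> by (intro image_eqI[of _ _ k]) auto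
    qed
  qed auto
  moreover have "?g u = f (Suc u)" using Suc.prems by simp
  ultimately show ?case
    using Suc.IH[OF circular_rotate[OF Suc.prems(1)]] Suc.prems(2) by auto
qed

text \<open>The order \<open>i, l, j, m, k\<close> comes from inverting the numbering: 3 is the
  inverse of 2 modulo 5, so the cyclic order visits positions 0, 3, 1, 4, 2 of the
  subsequence.\<close>

lemma circular_subsequence:
  assumes "circular n f" "i < j" "j < k" "k < l" "l < m" "m \<le> 2 * n"
    "odd (i + j)" "odd (j + k)" "odd (k + l)" "odd (l + m)"
  shows "T5_on (f i) (f l) (f j) (f m) (f k)"
  using assms by (auto simp: T5_on_def circular_verts[OF assms(1)] circular_arc[OF assms(1)]
      circular_eq_iff[OF assms(1)])

text \<open>The parity twist in \<open>t\<close> turns uniform vertices into alternating patterns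
  and twins into patterns with at most one change. The five rotations of the four types in
  \<open>T5_on_extension\<close> exclude the other 20 of the 32 patterns.\<close>

lemma outside_T5:
  assumes f: "circular n f" and x: "x \<in> pverts T" "x \<notin> f ` {..2 * n}"
    and no: "\<not> (embeds (U_tournament 2) T \<and> embeds (W_tournament 2) T)"
    and seq: "i < j" "j < k" "k < l" "l < m" "m \<le> 2 * n"
    "odd (i + j)" "odd (j + k)" "odd (k + l)" "odd (l + m)"
  defines "t \<equiv> \<lambda>i. f i \<rightarrow>\<^sub>T x \<longleftrightarrow> even i"
  shows "flat_or_alternating (t i) (t j) (t k) (t l) (t m)"
proof -
  have rev: "x \<rightarrow>\<^sub>T f p \<longleftrightarrow> \<not> f p \<rightarrow>\<^sub>T x" if "p \<le> 2 * n" for p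
    using arc_iff_no_reverse_arc[OF x(1) circular_verts[OF f that]] x(2) that by auto
  have outside: "x \<notin> {f i, f l, f j, f m, f k}" using x(2) seq by auto
  note T0 = circular_subsequence[OF f seq]
  note T1 = T5_on_rotate[OF T0] note T2 = T5_on_rotate[OF T1]
  note T3 = T5_on_rotate[OF T2] note T4 = T5_on_rotate[OF T3]
  have m: "i \<le> 2 * n" "j \<le> 2 * n" "k \<le> 2 * n" "l \<le> 2 * n" using seq by auto
  note revs = m[THEN rev] rev[OF seq(5)]
  have o: "x \<notin> {f l, f j, f m, f k, f i}" "x \<notin> {f j, f m, f k, f i, f l}"
    "x \<notin> {f m, f k, f i, f l, f j}" "x \<notin> {f k, f i, f l, f j, f m}" using outside by auto
  note facts = T5_on_extension[OF T0 x(1) outside no] T5_on_extension[OF T1 x(1) o(1) no]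
    T5_on_extension[OF T2 x(1) o(2) no] T5_on_extension[OF T3 x(1) o(3) no]
    T5_on_extension[OF T4 x(1) o(4) no]
  have par: "even j = (\<not> even i)" "even k = even i" "even l = (\<not> even i)" "even m = even i"
    using seq by presburger+
  show ?thesis
    using facts unfolding revs t_def par flat_or_alternating_def
    by (cases "f i \<rightarrow>\<^sub>T x"; cases "f j \<rightarrow>\<^sub>T x"; cases "f k \<rightarrow>\<^sub>T x"; cases "f l \<rightarrow>\<^sub>T x";
        cases "f m \<rightarrow>\<^sub>T x"; simp)
qed

lemma outside_circular:
  assumes f: "circular n f" and n: "2 \<le> n" and x: "x \<in> pverts T" "x \<notin> f ` {..2 * n}"
    and no: "\<not> (embeds (U_tournament 2) T \<and> embeds (W_tournament 2) T)"
  shows "(\<forall>i\<le>2 * n. f i \<rightarrow>\<^sub>T x) \<or> (\<forall>i\<le>2 * n. \<not> f i \<rightarrow>\<^sub>T x) \<or>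
    (\<exists>u\<le>2 * n. \<forall>i\<le>2 * n. i \<noteq> u \<longrightarrow> (f i \<rightarrow>\<^sub>T x \<longleftrightarrow> f i \<rightarrow>\<^sub>T f u))"
proof -
  define t where "t = (\<lambda>i. f i \<rightarrow>\<^sub>T x \<longleftrightarrow> even i)"
  have arc: "f i \<rightarrow>\<^sub>T x \<longleftrightarrow> t i = even i" for i by (auto simp: t_def)
  consider "\<forall>i<2 * n. t i \<noteq> t (i + 1)" | k b where "\<forall>i\<le>2 * n. t i = ((i < k) = b)"
    using changes_once_or_always[of n t] outside_T5[OF f x no] n unfolding t_def by blast
  then show ?thesis
  proof cases
    case 1
    have "f i \<rightarrow>\<^sub>T x \<longleftrightarrow> f 0 \<rightarrow>\<^sub>T x" if "i \<le> 2 * n" for i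
      using that by (induction i) (use 1 in \<open>auto simp: arc\<close>)
    then show ?thesis by blast
  next
    case 2
    \<comment> \<open>The change from position \<open>k - 1\<close> to \<open>k\<close> is that of a twin of position \<open>k - 1\<close> or \<open>k\<close>,
      whichever has the parity prescribed by \<open>b\<close>.\<close>
    have *: ?thesis if "u \<le> 2 * n" and agree: "\<And>i. i \<le> 2 * n \<Longrightarrow> i \<noteq> u \<Longrightarrow> ((i < k) = b) = (i < u \<longleftrightarrow> odd u)" for u
    proof -
      have "f i \<rightarrow>\<^sub>T x \<longleftrightarrow> f i \<rightarrow>\<^sub>T f u" if "i \<le> 2 * n" "i \<noteq> u" for i
        unfolding arc using 2 that \<open>u \<le> 2 * n\<close> agree[of i] circular_arc[OF f, of i u] by auto
      then show ?thesis using \<open>u \<le> 2 * n\<close> by blast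
    qed
    show ?thesis
    proof (cases "1 \<le> k \<and> k \<le> 2 * n")
      case True
      show ?thesis
      proof (cases "odd k = b")
        case k: True
        show ?thesis by (rule *[of k]) (use True k in auto)
      next
        case k: False
        have "i < k - 1 \<longleftrightarrow> i < k" if "i \<noteq> k - 1" for i using that by auto
        then show ?thesis by (intro *[of "k - 1"]) (use True k in auto)
      qed
    next
      case False
      \<comment> \<open>Here \<open>t\<close> is constant: \<open>x\<close> is a twin of the first
        position if the value is true, of the last if it is false.\<close>
      then have "(\<forall>i\<le>2 * n. ((i < k) = b) = True) \<or> (\<forall>i\<le>2 * n. ((i < k) = b) = False)" by auto
      then show ?thesis using *[of 0] *[of "2 * n"] by auto
    qed
  qed
qed

section \<open>Twins of a vertex of a copy\<close>

text \<open>The arc between \<open>p\<close> and \<open>x\<close> is left open, and \<open>p\<close>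
  is a twin of itself.\<close>

definition twin :: "'a set \<Rightarrow> 'a \<Rightarrow> 'a \<Rightarrow> bool" where
  "twin X p x \<longleftrightarrow> (\<forall>q\<in>X. q \<noteq> p \<longrightarrow> (q \<rightarrow>\<^sub>T x \<longleftrightarrow> q \<rightarrow>\<^sub>T p))"

lemma outside_circular_twin:
  assumes f: "circular n f" and "2 \<le> n" and "x \<in> pverts T" "x \<notin> f ` {..2 * n}"
    and "\<not> (embeds (U_tournament 2) T \<and> embeds (W_tournament 2) T)"
    and "i \<le> 2 * n" "f i \<rightarrow>\<^sub>T x" "j \<le> 2 * n" "\<not> f j \<rightarrow>\<^sub>T x"
  shows "\<exists>u\<le>2 * n. twin (f ` {..2 * n}) (f u) x"
proof -
  obtain u where u: "u \<le> 2 * n" "\<forall>i\<le>2 * n. i \<noteq> u \<longrightarrow> (f i \<rightarrow>\<^sub>T x \<longleftrightarrow> f i \<rightarrow>\<^sub>T f u)"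
    using outside_circular[OF assms(1-5)] assms(6-) by blast
  then have "twin (f ` {..2 * n}) (f u) x" by (auto simp: twin_def)
  with u(1) show ?thesis by blast
qed

lemma outside_reverse:
  assumes "circular n f" "x \<in> pverts T" "x \<notin> f ` {..2 * n}" "i \<le> 2 * n"
  shows "x \<rightarrow>\<^sub>T f i \<longleftrightarrow> \<not> f i \<rightarrow>\<^sub>T x"
  using arc_iff_no_reverse_arc[OF assms(2) circular_verts[OF assms(1,4)]] assms(3,4) by auto

lemma twin_index:
  assumes "circular n f" "u \<le> 2 * n" "twin (f ` {..2 * n}) (f u) x" "i \<le> 2 * n" "i \<noteq> u"
  shows "f i \<rightarrow>\<^sub>T x \<longleftrightarrow> (i < u \<longleftrightarrow> even i \<noteq> even u)"
  using assms circular_arc[OF assms(1,4,2)] circular_eq_iff[OF assms(1,4,2)]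
  by (auto simp: twin_def)

text \<open>\<open>x\<close> takes over all arcs of \<open>f u\<close> to the other positions, and
  \<open>f u\<close> itself leaves the copy, so the open arc between the two never enters.\<close>

lemma circular_replace:
  assumes f: "circular n f" and u: "u \<le> 2 * n"
    and x: "x \<in> pverts T" "x \<notin> f ` {..2 * n}" and tw: "twin (f ` {..2 * n}) (f u) x"
  shows "circular n (f(u := x))"
proof -
  have "(f(u := x)) i \<in> pverts T" if "i \<le> 2 * n" for i
    using that x(1) circular_verts[OF f] by simp
  moreover have "(f(u := x)) i \<rightarrow>\<^sub>T (f(u := x)) j \<longleftrightarrow> i \<noteq> j \<and> (i < j \<longleftrightarrow> even i \<noteq> even j)"
    if "i \<le> 2 * n" "j \<le> 2 * n" for i j
    using that twin_index[OF f u tw, of i] twin_index[OF f u tw, of j]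
      outside_reverse[OF f x, of j] circular_arc[OF f, of i j]
    by (auto simp: arc_irrefl)
  ultimately show ?thesis by (rule circularI)
qed

text \<open>The new positions lie above all old ones and are odd and even respectively;
  \<open>fx\<close>, \<open>fy\<close> and \<open>xy\<close> are exactly the arc rule for
  them.\<close>

lemma circular_append_two:
  assumes f: "circular n f" and x: "x \<in> pverts T" "x \<notin> f ` {..2 * n}"
    and y: "y \<in> pverts T" "y \<notin> f ` {..2 * n}" and xy: "x \<rightarrow>\<^sub>T y"
    and fx: "\<And>i. i \<le> 2 * n \<Longrightarrow> f i \<rightarrow>\<^sub>T x \<longleftrightarrow> even i"
    and fy: "\<And>i. i \<le> 2 * n \<Longrightarrow> f i \<rightarrow>\<^sub>T y \<longleftrightarrow> odd i"
  shows "circular (n + 1) (f(2 * n + 1 := x, 2 * n + 2 := y))" (is "circular _ ?g")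
proof -
  have "x \<noteq> y" using xy arc_irrefl by auto
  with xy have yx: "\<not> y \<rightarrow>\<^sub>T x" using arc_iff_no_reverse_arc[OF x(1) y(1)] by simp
  have less: "i \<le> 2 * n \<or> i = 2 * n + 1 \<or> i = 2 * n + 2" if "i \<le> 2 * (n + 1)" for i
    using that by auto
  have "?g i \<in> pverts T" if "i \<le> 2 * (n + 1)" for i
    using less[OF that] x(1) y(1) circular_verts[OF f, of i] by auto
  moreover have "?g i \<rightarrow>\<^sub>T ?g j \<longleftrightarrow> i \<noteq> j \<and> (i < j \<longleftrightarrow> even i \<noteq> even j)"
    if "i \<le> 2 * (n + 1)" "j \<le> 2 * (n + 1)" for i j
  proof -
    have I: "f i \<rightarrow>\<^sub>T x \<longleftrightarrow> even i" "f i \<rightarrow>\<^sub>T y \<longleftrightarrow> odd i" if "i \<le> 2 * n"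
      using fx fy that by blast+
    have J: "x \<rightarrow>\<^sub>T f j \<longleftrightarrow> odd j" "y \<rightarrow>\<^sub>T f j \<longleftrightarrow> even j" if "j \<le> 2 * n"
      using fx[OF that] fy[OF that] outside_reverse[OF f x that] outside_reverse[OF f y that] by blast+
    show ?thesis
      using less[OF that(1)] less[OF that(2)] I J xy yx circular_arc[OF f, of i j]
      by (elim disjE) (auto simp: arc_irrefl)
  qed
  ultimately show ?thesis by (rule circularI)
qed

text \<open>Every position has at least two in-neighbours and two out-neighbours, and
  \<open>u\<close> spoils at most one of each. Hence a twin of position \<open>w\<close> is seen to
  be non-uniform even without looking at position \<open>u\<close>.\<close>

lemma circular_mixed:
  assumes f: "circular n f" and "2 \<le> n" and w: "w \<le> 2 * n"
  shows "\<exists>i\<le>2 * n. i \<noteq> u \<and> i \<noteq> w \<and> f i \<rightarrow>\<^sub>T f w"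
    and "\<exists>i\<le>2 * n. i \<noteq> u \<and> i \<noteq> w \<and> \<not> f i \<rightarrow>\<^sub>T f w"
proof -
  have pick: "\<exists>i\<le>2 * n. i \<noteq> u \<and> i \<noteq> w \<and> P i"
    if "a \<noteq> b" "a \<noteq> w" "b \<noteq> w" "a \<le> 2 * n" "b \<le> 2 * n" "P a" "P b" for a b P
    using that by (cases "a = u") auto
  consider "w = 0" | "w = 1" | "w = 2" | "3 \<le> w" by linarith
  then show "\<exists>i\<le>2 * n. i \<noteq> u \<and> i \<noteq> w \<and> f i \<rightarrow>\<^sub>T f w"
  proof cases
    case 1 then show ?thesis using assms(2) by (intro pick[of 2 4]) (auto simp: circular_arc[OF f])
  next
    case 2 then show ?thesis using assms(2) by (intro pick[of 0 3]) (auto simp: circular_arc[OF f])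
  next
    case 3 then show ?thesis using assms(2) by (intro pick[of 1 4]) (auto simp: circular_arc[OF f])
  next
    case 4 then show ?thesis using w by (intro pick[of "w - 1" "w - 3"]) (auto simp: circular_arc[OF f])
  qed
  consider "w = 0" | "w = 1" | "w = 2" | "w = 3" | "4 \<le> w" by linarith
  then show "\<exists>i\<le>2 * n. i \<noteq> u \<and> i \<noteq> w \<and> \<not> f i \<rightarrow>\<^sub>T f w"
  proof cases
    case 1 then show ?thesis using assms(2) by (intro pick[of 1 3]) (auto simp: circular_arc[OF f])
  next
    case 2 then show ?thesis using assms(2) by (intro pick[of 2 4]) (auto simp: circular_arc[OF f])
  next
    case 3 then show ?thesis using assms(2) by (intro pick[of 0 3]) (auto simp: circular_arc[OF f])
  next
    case 4 then show ?thesis using assms(2) by (intro pick[of 1 4]) (auto simp: circular_arc[OF f])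
  next
    case 5 then show ?thesis using w by (intro pick[of "w - 2" "w - 4"]) (auto simp: circular_arc[OF f])
  qed
qed

section \<open>Enlarging a copy by two twins\<close>

text \<open>The arc between the twins opposes the one between \<open>f 0\<close> and
  \<open>f v\<close>. Once \<open>x\<close> replaces \<open>f 0\<close>, \<open>y\<close> must
  therefore be a twin of another position \<open>w\<close>. Comparing both descriptions of
  \<open>y\<close> forces \<open>w = 1\<close> and \<open>v = 2 * n\<close>, so \<open>x\<close> and
  \<open>y\<close> continue the numbering.\<close>

lemma circular_extend_by_linked_twins_of_0:
  assumes f: "circular n f" and n: "2 \<le> n"
    and no: "\<not> (embeds (U_tournament 2) T \<and> embeds (W_tournament 2) T)"
    and x: "x \<in> pverts T" "x \<notin> f ` {..2 * n}" "twin (f ` {..2 * n}) (f 0) x"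
    and y: "y \<in> pverts T" "y \<notin> f ` {..2 * n}" "twin (f ` {..2 * n}) (f v) y"
    and v: "v \<le> 2 * n" and vu: "f v \<rightarrow>\<^sub>T f 0" and xy: "x \<rightarrow>\<^sub>T y"
  shows "\<exists>g. circular (n + 1) g"
proof -
  have v0: "even v" "v \<noteq> 0" using vu circular_arc[OF f v, of 0] by auto
  then have "v \<noteq> 1" by auto
  have "x \<noteq> y" using xy arc_irrefl by auto
  with xy have yx: "\<not> y \<rightarrow>\<^sub>T x" using arc_iff_no_reverse_arc[OF x(1) y(1)] by simp
  have fy: "f i \<rightarrow>\<^sub>T y \<longleftrightarrow> (i < v \<longleftrightarrow> odd i)" if "i \<le> 2 * n" "i \<noteq> v" for i
    using twin_index[OF f v y(3) that] v0 by simp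
  have fx: "f i \<rightarrow>\<^sub>T x \<longleftrightarrow> even i" if "i \<le> 2 * n" "i \<noteq> 0" for i
    using twin_index[OF f _ x(3) that] by simp
  define g where "g = f(0 := x)"
  have g: "circular n g"
    unfolding g_def using circular_replace[OF f _ x] by simp
  have yg: "y \<notin> g ` {..2 * n}" using y(2) \<open>x \<noteq> y\<close> by (auto simp: g_def)
  obtain i j where "i \<le> 2 * n" "i \<noteq> 0" "i \<noteq> v" "f i \<rightarrow>\<^sub>T f v"
    and "j \<le> 2 * n" "j \<noteq> 0" "j \<noteq> v" "\<not> f j \<rightarrow>\<^sub>T f v"
    using circular_mixed[OF f n v, of 0] by blast
  then have gij: "g i \<rightarrow>\<^sub>T y" "\<not> g j \<rightarrow>\<^sub>T y"
    using y(3) circular_eq_iff[OF f _ v] by (auto simp: g_def twin_def)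
  then obtain w where w: "w \<le> 2 * n" and gw: "twin (g ` {..2 * n}) (g w) y"
    using outside_circular_twin[OF g n y(1) yg no \<open>i \<le> 2 * n\<close> gij(1) \<open>j \<le> 2 * n\<close> gij(2)] by blast
  note gy = twin_index[OF g w gw]
  have w0: "w \<noteq> 0"
  proof
    assume "w = 0"
    then show False
      using gy[of 1] fy[of 1] v0 \<open>v \<noteq> 1\<close> n by (auto simp: g_def)
  qed
  then have "odd w" using gy[of 0] xy by (auto simp: g_def)
  \<comment> \<open>With \<open>v\<close> even and \<open>w\<close> odd, both descriptions of
    \<open>y\<close> can hold at \<open>i\<close> only if \<open>i\<close> separates
    \<open>v\<close> from \<open>w\<close>; testing the extreme positions then pins down
    both.\<close>
  have between: "(i < v) \<noteq> (i < w)" if "1 \<le> i" "i \<le> 2 * n" "i \<noteq> v" "i \<noteq> w" for i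
    using gy[of i] fy[of i] that \<open>odd w\<close> by (auto simp: g_def)
  have "1 < v" using v0 \<open>v \<noteq> 1\<close> by simp
  have "w = 1" using between[of 1] \<open>1 < v\<close> w0 n by (cases "w = 1") auto
  have "v = 2 * n"
  proof (rule ccontr)
    assume "v \<noteq> 2 * n"
    then show False using between[of "2 * n"] v \<open>w = 1\<close> n by auto
  qed
  \<comment> \<open>This settles the arc between \<open>y\<close> and \<open>f v\<close>, which the
    twin condition left open.\<close>
  have fvy: "\<not> f (2 * n) \<rightarrow>\<^sub>T y"
    using gy[of "2 * n"] \<open>w = 1\<close> n by (auto simp: g_def)
  \<comment> \<open>The same exchange at the other end settles the open arc between \<open>x\<close>
    and \<open>f 0\<close>.\<close>
  define h where "h = f(2 * n := y)"
  have h: "circular n h"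
    unfolding h_def using circular_replace[OF f v y] \<open>v = 2 * n\<close> by simp
  have xh: "x \<notin> h ` {..2 * n}" using x(2) \<open>x \<noteq> y\<close> by (auto simp: h_def)
  have h21: "h 2 \<rightarrow>\<^sub>T x" "\<not> h 1 \<rightarrow>\<^sub>T x" using fx[of 2] fx[of 1] n by (auto simp: h_def)
  have "2 \<le> 2 * n" "1 \<le> 2 * n" using n by auto
  then obtain w' where w': "w' \<le> 2 * n" and hw: "twin (h ` {..2 * n}) (h w') x"
    using outside_circular_twin[OF h n x(1) xh no _ h21(1) _ h21(2)] by blast
  note hx = twin_index[OF h w' hw]
  have "w' \<noteq> 2 * n" using hx[of 1] fx[of 1] n by (auto simp: h_def)
  then have "odd w'" using hx[of "2 * n"] yx w' by (auto simp: h_def)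
  then have "w' \<noteq> 0" by (cases "w' = 0") simp_all
  have "f 0 \<rightarrow>\<^sub>T x" using hx[of 0] \<open>odd w'\<close> \<open>w' \<noteq> 0\<close> n by (auto simp: h_def)
  have "circular (n + 1) (f(2 * n + 1 := x, 2 * n + 2 := y))"
  proof (rule circular_append_two[OF f x(1,2) y(1,2) xy])
    show "f i \<rightarrow>\<^sub>T x \<longleftrightarrow> even i" if "i \<le> 2 * n" for i
      using fx[of i] that \<open>f 0 \<rightarrow>\<^sub>T x\<close> by (cases "i = 0") auto
    show "f i \<rightarrow>\<^sub>T y \<longleftrightarrow> odd i" if "i \<le> 2 * n" for i
      using fy[of i] that fvy \<open>v = 2 * n\<close> by (cases "i = v") auto
  qed
  then show ?thesis by blast
qed

text \<open>Rotation brings the vertex \<open>p\<close> to position 0.\<close>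

lemma circular_extend_by_linked_twins:
  assumes f: "circular n f" and "2 \<le> n"
    and "\<not> (embeds (U_tournament 2) T \<and> embeds (W_tournament 2) T)"
    and x: "x \<in> pverts T" "x \<notin> f ` {..2 * n}" "twin (f ` {..2 * n}) p x"
    and y: "y \<in> pverts T" "y \<notin> f ` {..2 * n}" "twin (f ` {..2 * n}) q y"
    and pq: "p \<in> f ` {..2 * n}" "q \<in> f ` {..2 * n}" "q \<rightarrow>\<^sub>T p" and xy: "x \<rightarrow>\<^sub>T y"
  shows "\<exists>g. circular (n + 1) g"
proof -
  obtain u where "u \<le> 2 * n" "p = f u" using pq(1) by auto
  then obtain g where g: "circular n g" "g ` {..2 * n} = f ` {..2 * n}" "g 0 = p"
    using circular_rotate_to_0[OF f] by blast
  obtain v where v: "v \<le> 2 * n" "q = g v" using pq(2) unfolding g(2)[symmetric] by auto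
  show ?thesis
    using circular_extend_by_linked_twins_of_0[OF g(1) assms(2,3)] x y pq(3) xy v g(2,3) by simp
qed

lemma circular_bound:
  assumes "circular n f"
  shows "n \<le> card (pverts T)"
proof -
  have "card (f ` {..2 * n}) \<le> card (pverts T)"
    using assms by (intro card_mono) (auto simp: circular_def)
  then show ?thesis using card_image[OF circular_inj[OF assms]] by simp
qed

section \<open>A maximal copy is the whole tournament\<close>

lemma circular_spans:
  assumes indec: "indecomposable T"
    and no: "\<not> (embeds (U_tournament 2) T \<and> embeds (W_tournament 2) T)"
    and f: "circular n f" and n: "2 \<le> n" and max: "\<nexists>g. circular (n + 1) g"
  shows "f ` {..2 * n} = pverts T"
proof (rule ccontr)
  let ?X = "f ` {..2 * n}"
  assume ne: "?X \<noteq> pverts T"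
  have XV: "?X \<subseteq> pverts T" using f by (auto simp: circular_def)
  show False
  proof (cases "\<exists>x\<in>pverts T - ?X. \<exists>u\<le>2 * n. twin ?X (f u) x")
    case True
    then obtain x0 u where x0: "x0 \<in> pverts T" "x0 \<notin> ?X" and u: "u \<le> 2 * n"
      and tw0: "twin ?X (f u) x0" by blast
    \<comment> \<open>The twin class of \<open>f u\<close>; the implication keeps all other vertices
      of the copy out of it.\<close>
    define C where "C = {x \<in> pverts T. (x \<in> ?X \<longrightarrow> x = f u) \<and> twin ?X (f u) x}"
    have fuC: "f u \<in> C" using circular_verts[OF f u] by (auto simp: C_def twin_def)
    have x0C: "x0 \<in> C" using x0 tw0 by (auto simp: C_def)
    obtain v where "v \<le> 2 * n" "v \<noteq> u" using n by (cases "u = 0") (auto intro: that[of 0] that[of 1])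
    then have "f v \<in> pverts T - C"
      using circular_verts[OF f] circular_eq_iff[OF f _ u] by (auto simp: C_def)
    moreover have "x0 \<noteq> f u" using x0(2) u by auto
    ultimately have "\<not> trivial_interval T C"
      using fuC x0C by (auto simp: trivial_interval_def)
    then have "\<not> interval T C" using indec by (auto simp: indecomposable_def)
    then obtain y a b where y: "y \<in> pverts T" "y \<notin> C" and ab: "a \<in> C" "b \<in> C"
      "\<not> y \<rightarrow>\<^sub>T a" "\<not> b \<rightarrow>\<^sub>T y"
      by (auto simp: interval_def C_def)
    have CV: "c \<in> pverts T" "c \<noteq> y" if "c \<in> C" for c using that y(2) by (auto simp: C_def)
    have rev: "y \<rightarrow>\<^sub>T c \<longleftrightarrow> \<not> c \<rightarrow>\<^sub>T y" if "c \<in> C" for c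
      using arc_iff_no_reverse_arc[OF y(1)] CV[OF that] by auto
    \<comment> \<open>Since \<open>y\<close> distinguishes \<open>a\<close> from \<open>b\<close>,
      it distinguishes one of them from \<open>f u\<close>.\<close>
    obtain x where xC: "x \<in> C" and sep: "(x \<rightarrow>\<^sub>T y) \<noteq> (f u \<rightarrow>\<^sub>T y)"
      using ab rev by blast
    then have "x \<noteq> f u" by auto
    then have x: "x \<in> pverts T" "x \<notin> ?X" "twin ?X (f u) x" using xC by (auto simp: C_def)
    have yX: "y \<notin> ?X"
    proof
      assume "y \<in> ?X"
      moreover have "y \<noteq> f u" using y(2) fuC by blast
      ultimately have "y \<rightarrow>\<^sub>T x \<longleftrightarrow> y \<rightarrow>\<^sub>T f u" using x(3) by (auto simp: twin_def)
      then show False using sep rev[OF xC] rev[OF fuC] by blast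
    qed
    define g where "g = f(u := x)"
    have g: "circular n g" unfolding g_def using circular_replace[OF f u x] .
    have yg: "y \<notin> g ` {..2 * n}" using yX CV(2)[OF xC] by (auto simp: g_def)
    \<comment> \<open>If \<open>y\<close> were uniform on the copy, only position \<open>u\<close>
      of \<open>g\<close> would deviate. But \<open>y\<close> would be a twin of some
      \<open>g w\<close>, which has arcs of both directions away from \<open>u\<close>.\<close>
    have "(\<exists>i\<le>2 * n. f i \<rightarrow>\<^sub>T y) \<and> (\<exists>j\<le>2 * n. \<not> f j \<rightarrow>\<^sub>T y)"
    proof (rule ccontr)
      assume "\<not> ?thesis"
      then have const: "f i \<rightarrow>\<^sub>T y \<longleftrightarrow> f u \<rightarrow>\<^sub>T y" if "i \<le> 2 * n" for i
        using that u by blast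
      obtain v where v: "v \<le> 2 * n" "v \<noteq> u" by fact+
      have gu: "g u \<rightarrow>\<^sub>T y \<longleftrightarrow> \<not> f u \<rightarrow>\<^sub>T y" using sep by (auto simp: g_def)
      have gi: "g i \<rightarrow>\<^sub>T y \<longleftrightarrow> f u \<rightarrow>\<^sub>T y" if "i \<le> 2 * n" "i \<noteq> u" for i
        using const[OF that(1)] that(2) by (simp add: g_def)
      have "\<exists>w\<le>2 * n. twin (g ` {..2 * n}) (g w) y"
      proof (cases "f u \<rightarrow>\<^sub>T y")
        case True
        then show ?thesis using outside_circular_twin[OF g n y(1) yg no v(1) _ u] gi[OF v] gu by blast
      next
        case False
        then show ?thesis using outside_circular_twin[OF g n y(1) yg no u _ v(1)] gi[OF v] gu by blast
      qed
      then obtain w where w: "w \<le> 2 * n" and tw: "twin (g ` {..2 * n}) (g w) y" by blast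
      obtain i j where ij: "i \<le> 2 * n" "i \<noteq> u" "i \<noteq> w" "g i \<rightarrow>\<^sub>T g w"
        "j \<le> 2 * n" "j \<noteq> u" "j \<noteq> w" "\<not> g j \<rightarrow>\<^sub>T g w"
        using circular_mixed[OF g n w, of u] by blast
      have "g i \<rightarrow>\<^sub>T y" "\<not> g j \<rightarrow>\<^sub>T y"
        using tw ij circular_eq_iff[OF g _ w] by (auto simp: twin_def)
      then show False using gi ij by blast
    qed
    then obtain i j where ij: "i \<le> 2 * n" "f i \<rightarrow>\<^sub>T y" "j \<le> 2 * n" "\<not> f j \<rightarrow>\<^sub>T y" by blast
    obtain v where v: "v \<le> 2 * n" and twy: "twin ?X (f v) y"
      using outside_circular_twin[OF f n y(1) yX no ij] by blast
    have "v \<noteq> u" using twy y yX by (auto simp: C_def)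
    then have fvu: "f u \<noteq> f v" using circular_eq_iff[OF f u v] by simp
    have uy: "f u \<rightarrow>\<^sub>T y \<longleftrightarrow> f u \<rightarrow>\<^sub>T f v" using twy u fvu by (auto simp: twin_def)
    have vu: "f v \<rightarrow>\<^sub>T f u \<longleftrightarrow> \<not> f u \<rightarrow>\<^sub>T f v"
      using arc_iff_no_reverse_arc[OF circular_verts[OF f v] circular_verts[OF f u]] fvu by auto
    have "f u \<in> ?X" "f v \<in> ?X" using u v by auto
    show False
    \<comment> \<open>The arc between \<open>x\<close> and \<open>y\<close> is opposite to that
      between \<open>f u\<close> and \<open>f v\<close>; its direction decides which twin is passed
      first to the extension lemma.\<close>
    proof (cases "x \<rightarrow>\<^sub>T y")
      case True
      then have "f v \<rightarrow>\<^sub>T f u" using sep uy vu by blast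
      then show False
        using circular_extend_by_linked_twins[OF f n no x y(1) yX twy] True max
          \<open>f u \<in> ?X\<close> \<open>f v \<in> ?X\<close> by blast
    next
      case False
      then have "f u \<rightarrow>\<^sub>T f v" "y \<rightarrow>\<^sub>T x" using sep uy rev[OF xC] by blast+
      then show False
        using circular_extend_by_linked_twins[OF f n no y(1) yX twy x] max
          \<open>f u \<in> ?X\<close> \<open>f v \<in> ?X\<close> by blast
    qed
  next
    case no_twin: False
    have "interval T ?X"
      unfolding interval_def
    proof (intro conjI ballI)
      fix x assume x: "x \<in> pverts T - ?X"
      then have "(\<forall>i\<le>2 * n. f i \<rightarrow>\<^sub>T x) \<or> (\<forall>i\<le>2 * n. \<not> f i \<rightarrow>\<^sub>T x)"
        using no_twin outside_circular_twin[OF f n _ _ no, of x] by blast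
      then show "(\<forall>y\<in>?X. x \<rightarrow>\<^sub>T y) \<or> (\<forall>y\<in>?X. y \<rightarrow>\<^sub>T x)"
        using outside_reverse[OF f, of x] x by auto
    qed (fact XV)
    then have "trivial_interval T ?X" using indec by (auto simp: indecomposable_def)
    then obtain x where "?X = {x}" using ne by (auto simp: trivial_interval_def)
    moreover have "f 0 \<in> ?X" "f 1 \<in> ?X" using n by auto
    ultimately have "f 0 = f 1" by simp
    then show False using circular_eq_iff[OF f, of 0 1] n by auto
  qed
qed

section \<open>Diamonds and their absence from circular copies\<close>

text \<open>The in-neighbours of a position are the lower ones of other parity and the higher ones
  of equal parity. The lower dominate the higher, and within each group arcs run downwards, so there
  is no 3-cycle; out-neighbours behave alike.\<close>

lemma circular_locally_transitive:
  assumes "circular n f" "i \<le> 2 * n" "j \<le> 2 * n" "k \<le> 2 * n" "l \<le> 2 * n"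
    and "f i \<rightarrow>\<^sub>T f j" "f j \<rightarrow>\<^sub>T f k" "f k \<rightarrow>\<^sub>T f i"
  shows "\<not> (f l \<rightarrow>\<^sub>T f i \<and> f l \<rightarrow>\<^sub>T f j \<and> f l \<rightarrow>\<^sub>T f k)"
    and "\<not> (f i \<rightarrow>\<^sub>T f l \<and> f j \<rightarrow>\<^sub>T f l \<and> f k \<rightarrow>\<^sub>T f l)"
  using assms(6-) unfolding circular_arc[OF assms(1,2,3)] circular_arc[OF assms(1,3,4)]
    circular_arc[OF assms(1,4,2)] circular_arc[OF assms(1,5,2)] circular_arc[OF assms(1,5,3)]
    circular_arc[OF assms(1,5,4)] circular_arc[OF assms(1,2,5)] circular_arc[OF assms(1,3,5)]
    circular_arc[OF assms(1,4,5)] by (cases "even i"; cases "even j"; cases "even k"; cases "even l"; auto)+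

lemma circular_if_embeds_T5:
  assumes "embeds (T_tournament 2) T"
  shows "\<exists>f. circular 2 f"
proof -
  have wf: "pair_wf_digraph (T_tournament 2)"
    using tournament_T by (simp add: tournament_def pair_digraph_def pair_fin_digraph_def)
  have V: "pverts (T_tournament 2) = {0..2 * 2}" by (simp add: T_tournament_def)
  obtain f where f: "f ` {0..2 * 2} \<subseteq> pverts T"
    "\<And>i j. i \<le> 4 \<Longrightarrow> j \<le> 4 \<Longrightarrow> (i, j) \<in> parcs (T_tournament 2) \<longleftrightarrow> f i \<rightarrow>\<^sub>T f j"
    using assms unfolding embeds_iff[OF wf] V by auto
  have range: "(2 * i) mod 5 \<le> 4" for i :: nat by presburger
  have "circular 2 (\<lambda>i. f ((2 * i) mod 5))"
    unfolding circular_def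
  proof (intro conjI allI impI)
    show "(\<lambda>i. f (2 * i mod 5)) ` {..2 * 2} \<subseteq> pverts T" using f(1) range by force
    fix i j :: nat assume "i \<le> 2 * 2" "j \<le> 2 * 2"
    then have "i \<in> {0, 1, 2, 3, 4}" "j \<in> {0, 1, 2, 3, 4}" by auto
    then show "f (2 * i mod 5) \<rightarrow>\<^sub>T f (2 * j mod 5) \<longleftrightarrow>
        i \<noteq> j \<and> (i < j \<longleftrightarrow> even i \<noteq> even j)"
      unfolding f(2)[OF range range, symmetric] T_arc_iff by auto
  qed
  then show ?thesis by blast
qed

text \<open>Any tournament on three vertices has a Hamiltonian path, leaving only the arc between
  \<open>a\<close> and \<open>c\<close> to be decided.\<close>

lemma three_vertices_path:
  assumes "I \<subseteq> pverts T" "card I = 3"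
  obtains a b c where "I = {a, b, c}" "distinct [a, b, c]" "a \<rightarrow>\<^sub>T b" "b \<rightarrow>\<^sub>T c"
proof -
  obtain a b c where abc: "I = {a, b, c}" "a \<noteq> b" "b \<noteq> c" "a \<noteq> c"
    using assms(2) by (auto simp: card_3_iff)
  have "a \<rightarrow>\<^sub>T b \<or> b \<rightarrow>\<^sub>T a" "b \<rightarrow>\<^sub>T c \<or> c \<rightarrow>\<^sub>T b" "a \<rightarrow>\<^sub>T c \<or> c \<rightarrow>\<^sub>T a"
    using abc assms(1) arc_iff_no_reverse_arc[of a b] arc_iff_no_reverse_arc[of b c]
      arc_iff_no_reverse_arc[of a c] by auto
  moreover have "I = {a, c, b}" "I = {b, a, c}" "I = {b, c, a}" "I = {c, a, b}" "I = {c, b, a}"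
    using abc(1) by auto
  moreover have "distinct [a, b, c]" "distinct [a, c, b]" "distinct [b, a, c]"
    "distinct [b, c, a]" "distinct [c, a, b]" "distinct [c, b, a]"
    using abc(2-4) by auto
  ultimately show ?thesis using that abc(1) by metis
qed

text \<open>If the 3-element interval were transitive, the fourth vertex, a source or a sink, would
  make the whole tournament transitive, giving a second interval of size 3.\<close>

lemma diamond_cycle:
  assumes "diamond T"
  obtains a b c d where "{a, b, c, d} \<subseteq> pverts T"
    "a \<rightarrow>\<^sub>T b" "b \<rightarrow>\<^sub>T c" "c \<rightarrow>\<^sub>T a"
    "(d \<rightarrow>\<^sub>T a \<and> d \<rightarrow>\<^sub>T b \<and> d \<rightarrow>\<^sub>T c) \<or> (a \<rightarrow>\<^sub>T d \<and> b \<rightarrow>\<^sub>T d \<and> c \<rightarrow>\<^sub>T d)"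
proof -
  obtain I where I: "interval T I" "card I = 3"
    and uniq: "\<And>J. interval T J \<Longrightarrow> card J = 3 \<Longrightarrow> J = I"
    and V4: "card (pverts T) = 4"
    using assms unfolding diamond_def by blast
  have IV: "I \<subseteq> pverts T" using I(1) by (simp add: interval_def)
  have "card (pverts T - I) = 1"
    using card_Diff_subset[OF finite_subset[OF IV pair_finite_verts] IV] I(2) V4 by simp
  then obtain d where d: "pverts T - I = {d}" by (auto simp: card_1_singleton_iff)
  obtain a b c where abc: "I = {a, b, c}" "distinct [a, b, c]" "a \<rightarrow>\<^sub>T b" "b \<rightarrow>\<^sub>T c"
    using three_vertices_path[OF IV I(2)] .
  have V: "pverts T = {a, b, c, d}" and dI: "d \<noteq> a" "d \<noteq> b" "d \<noteq> c"
    using d IV abc(1) by auto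
  have dir: "(d \<rightarrow>\<^sub>T a \<and> d \<rightarrow>\<^sub>T b \<and> d \<rightarrow>\<^sub>T c) \<or> (a \<rightarrow>\<^sub>T d \<and> b \<rightarrow>\<^sub>T d \<and> c \<rightarrow>\<^sub>T d)"
    using I(1) d unfolding interval_def abc(1) by blast
  have "c \<rightarrow>\<^sub>T a"
  proof (rule ccontr)
    assume "\<not> c \<rightarrow>\<^sub>T a"
    then have ac: "a \<rightarrow>\<^sub>T c" using arc_iff_no_reverse_arc[of a c] abc(2) V by auto
    from dir show False
    proof (elim disjE conjE)
      assume "d \<rightarrow>\<^sub>T c"
      then have "interval T {d, a, b}"
        using abc(2-4) ac V dI by (auto simp: interval_def)
      then have "{d, a, b} = I" using abc(2) dI by (intro uniq) auto
      then show False using dI abc(1) by auto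
    next
      assume "a \<rightarrow>\<^sub>T d"
      then have "interval T {b, c, d}"
        using abc(2-4) ac V dI by (auto simp: interval_def)
      then have "{b, c, d} = I" using abc(2) dI by (intro uniq) auto
      then show False using dI abc(1) by auto
    qed
  qed
  then show ?thesis using that[of a b c d] V abc(3,4) dir by blast
qed

end

theorem theorem3:
  fixes T :: "'a pair_pre_digraph" and D :: "'b pair_pre_digraph"
  assumes "tournament T" and "indecomposable T"
    and "diamond D" and "embeds D T"
    and "embeds (T_tournament 2) T"
  shows "embeds (U_tournament 2) T \<and> embeds (W_tournament 2) T"
proof (rule ccontr)
  assume no: "\<not> ?thesis"
  interpret tournament T by fact
  interpret D: tournament D using assms(3) by (simp add: diamond_def)
  \<comment> \<open>The maximum exists by \<open>ex\<close> and \<open>bound\<close>, and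
    \<open>greatest[OF ex]\<close> later gives \<open>2 \<le> n\<close>.\<close>
  define n where "n = (GREATEST n. \<exists>f. circular n f)"
  have ex: "\<exists>f. circular 2 f" using circular_if_embeds_T5[OF assms(5)] .
  have bound: "m \<le> card (pverts T)" if "\<exists>f. circular m f" for m using circular_bound that by blast
  obtain f where f: "circular n f"
    using GreatestI_nat[of "\<lambda>n. \<exists>f. circular n f", OF ex bound] unfolding n_def by (rule exE)
  have greatest: "m \<le> n" if "\<exists>g. circular m g" for m
    unfolding n_def by (rule Greatest_le_nat[of "\<lambda>n. \<exists>f. circular n f", OF that bound])
  have "\<nexists>g. circular (n + 1) g"
  proof
    assume "\<exists>g. circular (n + 1) g"
    from greatest[OF this] show False by simp
  qed
  then have span: "f ` {..2 * n} = pverts T"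
    by (rule circular_spans[OF assms(2) no f greatest[OF ex]])
  obtain g where gV: "g ` pverts D \<subseteq> pverts T"
    and g: "\<forall>x\<in>pverts D. \<forall>y\<in>pverts D. (x, y) \<in> parcs D \<longleftrightarrow> (g x, g y) \<in> parcs T"
    using assms(4) unfolding embeds_iff[OF D.pair_wf_digraph_axioms] by (elim exE conjE)
  have garc: "(x, y) \<in> parcs D \<longleftrightarrow> (g x, g y) \<in> parcs T" if "x \<in> pverts D" "y \<in> pverts D" for x y
    by (rule bspec[OF bspec[OF g that(1)] that(2)])
  obtain a b c d where abcd: "{a, b, c, d} \<subseteq> pverts D"
    and cycle: "(a, b) \<in> parcs D" "(b, c) \<in> parcs D" "(c, a) \<in> parcs D"
    and apex: "((d, a) \<in> parcs D \<and> (d, b) \<in> parcs D \<and> (d, c) \<in> parcs D) \<or>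
      ((a, d) \<in> parcs D \<and> (b, d) \<in> parcs D \<and> (c, d) \<in> parcs D)"
    using D.diamond_cycle[OF assms(3)] .
  have verts: "a \<in> pverts D" "b \<in> pverts D" "c \<in> pverts D" "d \<in> pverts D"
    using abcd by auto
  have ex_index: "\<exists>i\<le>2 * n. g v = f i" if "v \<in> pverts D" for v
    using gV span that by blast
  obtain i where i: "i \<le> 2 * n" "g a = f i" using ex_index[OF verts(1)] by blast
  obtain j where j: "j \<le> 2 * n" "g b = f j" using ex_index[OF verts(2)] by blast
  obtain k where k: "k \<le> 2 * n" "g c = f k" using ex_index[OF verts(3)] by blast
  obtain l where l: "l \<le> 2 * n" "g d = f l" using ex_index[OF verts(4)] by blast
  have arcs: "f i \<rightarrow>\<^sub>T f j" "f j \<rightarrow>\<^sub>T f k" "f k \<rightarrow>\<^sub>T f i"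
    using cycle garc[OF verts(1,2)] garc[OF verts(2,3)] garc[OF verts(3,1)] i(2) j(2) k(2)
    by (simp_all only:)
  note nt = circular_locally_transitive[OF f i(1) j(1) k(1) l(1) arcs]
  show False
    using nt apex garc[OF verts(4,1)] garc[OF verts(4,2)] garc[OF verts(4,3)]
      garc[OF verts(1,4)] garc[OF verts(2,4)] garc[OF verts(3,4)]
    unfolding i(2) j(2) k(2) l(2) by argo
qed

end
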